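(* Let $j$ be a positive integer such that the fibbinary number $\mathrm{fib}(j)$ is odd, and suppose that $\mathrm{fib}(j)$ is the $n$th odd fibbinary number, i.e. $\mathrm{fib}(j)=\mathrm{odfib}(n)$, equivalently $j = Z(n)$. Then for every $n\ge 1$, $$ j = Z(n) = \left\lfloor n\phi^2\right\rfloor - 1 = \left\lfloor n\phi\right\rfloor + n - 1, $$ where $\phi = \frac{1+\sqrt5}{2}$ is the golden ratio.
   Context: The Fibonacci numbers are defined by $F_0=0$, $F_1=1$, $F_n=F_{n-1}+F_{n-2}$ for $n\ge 2$. By Zeckendorf's theorem every positive integer $m$ can be written uniquely as $m = F_{i_1}+F_{i_2}+\dots+F_{i_k}$ with $i_1>i_2>\dots>i_k\ge 2$ and $i_{t}-i_{t+1}\ge 2$ for all $t$ (the summand $1$ is always taken as $F_2$). The fibbinary function is $\mathrm{fib}(m) := \sum_{t=1}^k 2^{i_t-2}$; it is a strictly increasing bijection from the positive integers onto the positive integers whose binary representation contains no two consecutive ones (the "fibbinary numbers"). Let $\mathrm{odfib}(n)$ denote the $n$th odd fibbinary number in increasing order (so $\mathrm{odfib}(1)=1$, $\mathrm{odfib}(2)=5=101_2$, $\mathrm{odfib}(3)=9=1001_2,\dots$), and let $Z(n) := \mathrm{fib}^{-1}(\mathrm{odfib}(n))$, so $Z(1)=1, Z(2)=4, Z(3)=6, Z(4)=9,\dots$. *)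

theory Defs
  imports Complex_Main "HOL-Number_Theory.Fib" "HOL-Library.Infinite_Set"
begin

text \<open>
  The summands $F_{i_1}, \dots, F_{i_k}$ of a Zeckendorf representation are given by the finite
  set of their indices; indices start at 2, so the summand 1 is always \<^term>\<open>fib 2\<close>.
\<close>

definition zeckendorf_rep :: "nat set \<Rightarrow> nat \<Rightarrow> bool" where
  "zeckendorf_rep I m \<longleftrightarrow>
     finite I \<and> (\<forall>i\<in>I. 2 \<le> i) \<and> (\<forall>i\<in>I. \<forall>i'\<in>I. i' < i \<longrightarrow> 2 \<le> i - i') \<and>
     m = (\<Sum>i\<in>I. fib i)"

definition zeckendorf :: "nat \<Rightarrow> nat set" where
  "zeckendorf m = (THE I. zeckendorf_rep I m)"

text \<open>The paper's $\mathrm{fib}$; the library's \<^const>\<open>fib\<close> is the Fibonacci sequence.\<close>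

definition fibbin :: "nat \<Rightarrow> nat" where
  "fibbin m = (\<Sum>i\<in>zeckendorf m. 2 ^ (i - 2))"

definition fibbinary_numbers :: "nat set" where
  "fibbinary_numbers = {b. 0 < b \<and> (\<forall>k. \<not> (bit b k \<and> bit b (Suc k)))}"

text \<open>
  The index of \<open>odfib\<close> starts at 1, whereas \<^const>\<open>enumerate\<close> (increasing enumeration)
  starts at 0. The value \<open>odfib 0\<close> is meaningless.
\<close>

definition odfib :: "nat \<Rightarrow> nat" where
  "odfib n = enumerate {b \<in> fibbinary_numbers. odd b} (n - 1)"

definition Z :: "nat \<Rightarrow> nat" where
  "Z n = inv_into {0<..} fibbin (odfib n)"

definition golden_ratio :: real where
  "golden_ratio = (1 + sqrt 5) / 2"

end

theory Submission
  imports Defs "HOL-Library.Nat_Bijection"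
begin

text \<open>
  Comparing two Zeckendorf index sets at the largest index where they differ shows that
  \<^const>\<open>fibbin\<close> is well defined and strictly increasing. If \<open>m\<close> has the index set \<open>I\<close>, the
  numbers \<open>j\<close> with odd \<^term>\<open>fibbin j\<close> are exactly the
  \<open>j = 1 + (\<Sum>i\<in>I. fib (i + 2))\<close>, and then \<open>fibbin j = 4 * fibbin m + 1\<close>; so this \<open>j\<close> is
  \<^term>\<open>Z (m + 1)\<close>. Since \<open>fib (i + 1) - \<phi> * fib i = (1 - \<phi>) ^ i\<close>, the difference between
  \<open>\<Sum>i\<in>I. fib (i + 1)\<close> and \<open>\<phi> * m\<close> is a sum of distinct powers of \<open>1 - \<phi>\<close> with exponents at
  least 2. Such a sum lies in an interval of length 1, whose right end is \<open>\<phi> - 1\<close>; this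
  turns \<open>j\<close> into the claimed floor.
\<close>

section \<open>Zeckendorf representations\<close>

lemma zeckendorf_rep_subset:
  assumes "zeckendorf_rep I m" "J \<subseteq> I"
  shows "zeckendorf_rep J (\<Sum>i\<in>J. fib i)"
  using assms unfolding zeckendorf_rep_def by (meson finite_subset subsetD)

text \<open>If \<open>k - 1\<close> occurs, the gap condition pushes all other indices below
  \<open>k - 2\<close>, and the recurrence for \<open>fib k\<close> closes the induction; otherwise
  the bound for \<open>k - 1\<close> already suffices.\<close>

lemma zeckendorf_rep_less_fib:
  assumes "zeckendorf_rep I m" "\<And>i. i \<in> I \<Longrightarrow> i < k" "0 < k"
  shows "m < fib k"
  using assms
proof (induction k arbitrary: I m rule: less_induct)
  case (less k)
  have fin: "finite I" and ge2: "\<And>i. i \<in> I \<Longrightarrow> 2 \<le> i" and m: "m = (\<Sum>i\<in>I. fib i)"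
    and gap: "\<And>i i'. i \<in> I \<Longrightarrow> i' \<in> I \<Longrightarrow> i' < i \<Longrightarrow> 2 \<le> i - i'"
    using less.prems(1) unfolding zeckendorf_rep_def by auto
  show ?case
  proof (cases "k - 1 \<in> I")
    case True
    have "3 \<le> k" using ge2[OF True] by linarith
    then obtain l where k: "k = l + 3"
      by (metis add.commute le_Suc_ex)
    have "(\<Sum>i\<in>I - {k - 1}. fib i) < fib (l + 1)"
    proof (rule less.IH[OF _ zeckendorf_rep_subset[OF less.prems(1)]])
      fix i assume i: "i \<in> I - {k - 1}"
      then have "i < k - 1"
        using less.prems(2)[of i] by auto
      then show "i < l + 1"
        using gap[OF True, of i] i k by auto
    qed (use k in auto)
    moreover have "m = fib (l + 2) + (\<Sum>i\<in>I - {k - 1}. fib i)"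
      using m fin True k by (simp add: sum.remove numeral_3_eq_3 numeral_2_eq_2)
    ultimately show ?thesis
      by (simp add: k numeral_3_eq_3 numeral_2_eq_2)
  next
    case False
    show ?thesis
    \<comment> \<open>Here the induction hypothesis would be needed at 0, where it says nothing; but
      no index below 1 is allowed, so the sum is empty.\<close>
    proof (cases "k = 1")
      case True
      then have "I = {}" using less.prems(2) ge2 by fastforce
      then show ?thesis using m True by simp
    next
      case k1: False
      have "m < fib (k - 1)"
      proof (rule less.IH[OF _ less.prems(1)])
        fix i assume "i \<in> I"
        then show "i < k - 1"
          using less.prems(2)[of i] False by (cases "i = k - 1") auto
      qed (use k1 less.prems(3) in auto)
      also have "\<dots> \<le> fib k" by (simp add: fib_mono)
      finally show ?thesis .
    qed
  qed
qed

lemma ex_top_difference: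
  fixes I J :: "'a::linorder set"
  assumes "finite I" "finite J" "I \<noteq> J"
  obtains k where "k \<in> I \<longleftrightarrow> k \<notin> J" "\<And>i. k < i \<Longrightarrow> i \<in> I \<longleftrightarrow> i \<in> J"
proof -
  let ?D = "(I - J) \<union> (J - I)"
  have fin: "finite ?D" and ne: "?D \<noteq> {}"
    using assms by auto
  have "Max ?D \<in> ?D" by (rule Max_in[OF fin ne])
  moreover have "i \<notin> ?D" if "Max ?D < i" for i
    using Max_ge[OF fin] that by (meson leD)
  ultimately show ?thesis using that[of "Max ?D"] by blast
qed

text \<open>Above \<open>k\<close> the two sums agree, and \<open>w k\<close> alone outweighs all
  that \<open>I\<close> has below \<open>k\<close>. The weight is left general so as to cover both
  Fibonacci numbers and powers of two.\<close>

lemma sum_less_top_difference: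
  fixes w :: "nat \<Rightarrow> nat"
  assumes "finite I" "finite J" "k \<in> J" "k \<notin> I" "\<And>i. k < i \<Longrightarrow> i \<in> I \<longleftrightarrow> i \<in> J"
    and "sum w (I \<inter> {..<k}) < w k"
  shows "sum w I < sum w J"
proof -
  have "I = (I \<inter> {..<k}) \<union> (I \<inter> {k<..})"
    using assms(4) by (auto simp: not_less_iff_gr_or_eq)
  moreover have "sum w ((I \<inter> {..<k}) \<union> (I \<inter> {k<..}))
      = sum w (I \<inter> {..<k}) + sum w (I \<inter> {k<..})"
    using assms(1) by (intro sum.union_disjoint) auto
  ultimately have "sum w I = sum w (I \<inter> {..<k}) + sum w (I \<inter> {k<..})"
    by simp
  also have "\<dots> < w k + sum w (I \<inter> {k<..})"
    using assms(6) by simp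
  also have "\<dots> = sum w (insert k (I \<inter> {k<..}))"
    using assms(1) by simp
  also have "\<dots> \<le> sum w J"
    using assms by (intro sum_mono2) auto
  finally show ?thesis .
qed

lemma zeckendorf_less_top_difference:
  assumes I: "zeckendorf_rep I m" and J: "zeckendorf_rep J n"
    and k: "k \<in> J" "k \<notin> I" "\<And>i. k < i \<Longrightarrow> i \<in> I \<longleftrightarrow> i \<in> J"
  shows "m < n" "set_encode I < set_encode J"
proof -
  have fin: "finite I" "finite J" and mn: "m = sum fib I" "n = sum fib J" and "2 \<le> k"
    using I J k unfolding zeckendorf_rep_def by auto
  then have "sum fib (I \<inter> {..<k}) < fib k"
    by (intro zeckendorf_rep_less_fib[OF zeckendorf_rep_subset[OF I]]) auto
  with fin k mn show "m < n"
    using sum_less_top_difference[of I J k fib] by simp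
  have "sum ((^) 2) (I \<inter> {..<k}) \<le> sum ((^) (2::nat)) {..<k}"
    by (intro sum_mono2) auto
  also have "\<dots> < 2 ^ k"
    by (simp add: lessThan_atLeast0 sum_power2)
  finally show "set_encode I < set_encode J"
    using sum_less_top_difference[of I J k "(^) 2"] fin k by (simp add: set_encode_def)
qed

text \<open>The largest index in which the sets differ decides both comparisons in the same way.
  Uniqueness of representations and monotonicity of \<open>fibbin\<close> both follow from
  this.\<close>

lemma zeckendorf_rep_less_iff:
  assumes I: "zeckendorf_rep I m" and J: "zeckendorf_rep J n"
  shows "m < n \<longleftrightarrow> set_encode I < set_encode J"
proof (cases "I = J")
  case True
  then show ?thesis using I J by (simp add: zeckendorf_rep_def)
next
  case False
  then obtain k where "k \<in> I \<longleftrightarrow> k \<notin> J" "\<And>i. k < i \<Longrightarrow> i \<in> I \<longleftrightarrow> i \<in> J"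
    using ex_top_difference[of I J] I J unfolding zeckendorf_rep_def by metis
  then show ?thesis
    using zeckendorf_less_top_difference[OF I J, of k]
      zeckendorf_less_top_difference[OF J I, of k] by (cases "k \<in> I") auto
qed

lemma zeckendorf_rep_unique:
  assumes "zeckendorf_rep I m" "zeckendorf_rep J m"
  shows "I = J"
proof -
  have "set_encode I = set_encode J"
    using zeckendorf_rep_less_iff[OF assms] zeckendorf_rep_less_iff[OF assms(2,1)] by simp
  then show ?thesis
    using assms set_encode_eq by (simp add: zeckendorf_rep_def)
qed

text \<open>A crude growth bound, which guarantees that the greedy choice of a largest Fibonacci
  summand exists.\<close>

lemma le_fib_Suc: "n \<le> fib (Suc n)"
proof (induction n rule: fib.induct)
  case (3 n)
  then show ?case using fib_neq_0_nat[of "Suc n"] by simp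
qed auto

text \<open>Greedy algorithm: after the largest possible \<open>fib k\<close> is removed, the
  remainder is below \<open>fib (k - 1)\<close>, so its indices stay below \<open>k - 1\<close> and
  the gap is respected.\<close>

lemma zeckendorf_rep_exists: "\<exists>I. zeckendorf_rep I m"
proof (induction m rule: less_induct)
  case (less m)
  show ?case
  proof (cases "m = 0")
    case True
    then have "zeckendorf_rep {} m" by (simp add: zeckendorf_rep_def)
    then show ?thesis ..
  next
    case False
    \<comment> \<open>Thus \<open>fib k \<le> m < fib (Suc k)\<close>. As
      \<open>fib 1 = fib 2 = 1\<close>, a positive \<open>m\<close> forces \<open>k \<ge> 2\<close>,
      so the summand 1 gets index 2.\<close>
    define k where "k = (LEAST k. m < fib (Suc k))"
    have "m < fib (Suc (Suc m))"
      using le_fib_Suc[of "Suc m"] by simp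
    then have up: "m < fib (Suc k)"
      unfolding k_def by (rule LeastI)
    have low: "fib (Suc i) \<le> m" if "i < k" for i
      using not_less_Least that unfolding k_def by fastforce
    have k2: "2 \<le> k"
    proof (rule ccontr)
      assume "\<not> 2 \<le> k"
      then have "k = 0 \<or> k = 1" by auto
      then show False using up False by auto
    qed
    have km: "fib k \<le> m" using low[of "k - 1"] k2 by simp
    have "0 < fib k" using k2 by (simp add: fib_neq_0_nat)
    then obtain I where I: "zeckendorf_rep I (m - fib k)"
      using less[of "m - fib k"] False by auto
    have "fib (Suc k) = fib k + fib (k - 1)"
      using k2 by (cases k) auto
    then have r: "m - fib k < fib (k - 1)"
      using up km by linarith
    have small: "i < k - 1" if "i \<in> I" for i
    proof (rule ccontr)
      assume "\<not> i < k - 1"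
      then have "fib (k - 1) \<le> fib i" by (simp add: fib_mono)
      also have "\<dots> \<le> m - fib k"
        using I that unfolding zeckendorf_rep_def by (simp add: member_le_sum)
      finally show False using r by simp
    qed
    have "k \<notin> I" using small by fastforce
    then have "zeckendorf_rep (insert k I) m"
      using I km k2 small unfolding zeckendorf_rep_def
      by (auto dest: small)
    then show ?thesis ..
  qed
qed

lemma zeckendorf_eq: "zeckendorf_rep I m \<Longrightarrow> zeckendorf m = I"
  unfolding zeckendorf_def using zeckendorf_rep_unique by (intro the_equality)

lemma zeckendorf_rep_zeckendorf: "zeckendorf_rep (zeckendorf m) m"
proof -
  obtain I where "zeckendorf_rep I m" using zeckendorf_rep_exists ..
  then show ?thesis using zeckendorf_eq by simp
qed

text \<open>The factor 4 undoes the exponent shift \<open>i - 2\<close>, which never truncates. Bit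
  positions of \<open>4 * fibbin m\<close> are therefore the Zeckendorf indices themselves.\<close>

lemma set_encode_zeckendorf: "set_encode (zeckendorf m) = 4 * fibbin m"
proof -
  have "(2::nat) ^ i = 4 * 2 ^ (i - 2)" if "i \<in> zeckendorf m" for i
  proof -
    have "2 \<le> i" using zeckendorf_rep_zeckendorf that unfolding zeckendorf_rep_def by auto
    then obtain l where "i = l + 2" by (metis add.commute le_Suc_ex)
    then show ?thesis by simp
  qed
  then show ?thesis
    unfolding set_encode_def fibbin_def sum_distrib_left by (rule sum.cong[OF refl])
qed

lemma fibbin_less_iff: "fibbin m < fibbin n \<longleftrightarrow> m < n"
  using zeckendorf_rep_less_iff[OF zeckendorf_rep_zeckendorf zeckendorf_rep_zeckendorf, of m n]
  by (simp add: set_encode_zeckendorf)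

lemma inj_fibbin: "inj fibbin"
proof (rule injI)
  fix m n assume "fibbin m = fibbin n"
  then show "m = n"
    using fibbin_less_iff[of m n] fibbin_less_iff[of n m] by simp
qed

section \<open>Odd fibbinary numbers\<close>

text \<open>Raising all indices by two makes room for the new summand \<open>1 = fib 2\<close>; on
  the binary side this appends the digits 01.\<close>

definition odd_lift :: "nat \<Rightarrow> nat" where
  "odd_lift m = 1 + (\<Sum>i\<in>zeckendorf m. fib (i + 2))"

lemma zeckendorf_rep_odd_lift:
  assumes "zeckendorf_rep I m"
  shows "zeckendorf_rep (insert 2 ((\<lambda>i. i + 2) ` I)) (odd_lift m)"
proof -
  have "2 \<notin> (\<lambda>i. i + 2) ` I"
    using assms unfolding zeckendorf_rep_def by auto
  then have "(\<Sum>i\<in>insert 2 ((\<lambda>i. i + 2) ` I). fib i) = odd_lift m"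
    using assms zeckendorf_eq[OF assms]
    by (simp add: zeckendorf_rep_def odd_lift_def sum.reindex inj_on_def del: add_2_eq_Suc')
  then show ?thesis
    using assms unfolding zeckendorf_rep_def by auto
qed

lemma fibbin_odd_lift: "fibbin (odd_lift m) = 4 * fibbin m + 1"
proof -
  let ?I = "zeckendorf m"
  have "finite ?I" "0 \<notin> ?I"
    using zeckendorf_rep_zeckendorf[of m] unfolding zeckendorf_rep_def by auto
  then have "set_encode (insert 2 ((\<lambda>i. i + 2) ` ?I)) = 4 * (set_encode ?I + 1)"
    by (subst set_encode_insert)
      (auto simp: set_encode_def sum.reindex inj_on_def sum_distrib_left)
  then show ?thesis
    using set_encode_zeckendorf[of "odd_lift m"] set_encode_zeckendorf[of m]
      zeckendorf_eq[OF zeckendorf_rep_odd_lift[OF zeckendorf_rep_zeckendorf, of m]]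
    by simp
qed

lemma fibbinary_numbers_iff:
  "b \<in> fibbinary_numbers \<longleftrightarrow> 0 < b \<and> (\<forall>k. \<not> (k \<in> set_decode b \<and> Suc k \<in> set_decode b))"
  by (simp add: fibbinary_numbers_def set_decode_def bit_iff_odd)

text \<open>In an odd fibbinary number bit 0 is set and bit 1 is not; the set bits from position 2
  on form an arbitrary Zeckendorf index set, possibly empty.\<close>

lemma range_odd_fibbinary:
  "range (\<lambda>m. fibbin (odd_lift m)) = {b \<in> fibbinary_numbers. odd b}"
proof (intro equalityI subsetI)
  fix b assume "b \<in> range (\<lambda>m. fibbin (odd_lift m))"
  then obtain m where b: "b = 4 * fibbin m + 1"
    by (auto simp: fibbin_odd_lift)
  let ?I = "zeckendorf m"
  have I: "finite ?I" "\<And>i. i \<in> ?I \<Longrightarrow> 2 \<le> i"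
    and gap: "\<And>i i'. i \<in> ?I \<Longrightarrow> i' \<in> ?I \<Longrightarrow> i' < i \<Longrightarrow> 2 \<le> i - i'"
    using zeckendorf_rep_zeckendorf[of m] unfolding zeckendorf_rep_def by blast+
  have "set_encode (insert 0 ?I) = b"
    using I(1) I(2)[of 0] b set_encode_zeckendorf[of m] by (subst set_encode_insert) auto
  then have "set_decode b = insert 0 ?I"
    using set_encode_inverse[of "insert 0 ?I"] I(1) by simp
  then show "b \<in> {b \<in> fibbinary_numbers. odd b}"
    using I(2)[of 1] gap[of "Suc _"] b
    by (force simp: fibbinary_numbers_iff simp del: set_decode_Suc)
next
  fix b assume b: "b \<in> {b \<in> fibbinary_numbers. odd b}"
  define I where "I = set_decode b - {0}"
  have b0: "0 \<in> set_decode b" and bk: "\<And>k. k \<in> set_decode b \<Longrightarrow> Suc k \<notin> set_decode b"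
    using b by (auto simp: fibbinary_numbers_iff)
  \<comment> \<open>Position 0 has been removed, and position 1 is excluded as a neighbour of the
    set bit 0.\<close>
  have "2 \<le> i" if "i \<in> I" for i
    using that bk[OF b0] unfolding I_def
    by (cases i rule: fib.cases) auto
  moreover have "2 \<le> i - i'" if "i \<in> I" "i' \<in> I" "i' < i" for i i'
    using that bk[of i'] unfolding I_def by (cases "i = Suc i'") auto
  ultimately have "zeckendorf_rep I (\<Sum>i\<in>I. fib i)"
    by (simp add: zeckendorf_rep_def I_def)
  then have "set_encode I = 4 * fibbin (\<Sum>i\<in>I. fib i)"
    by (simp add: zeckendorf_eq flip: set_encode_zeckendorf)
  moreover have "b = 1 + set_encode I"
  proof -
    have "set_encode (insert 0 I) = 1 + set_encode I"
      by (subst set_encode_insert) (auto simp: I_def)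
    moreover have "insert 0 I = set_decode b"
      using b0 by (auto simp: I_def)
    ultimately show ?thesis by simp
  qed
  ultimately show "b \<in> range (\<lambda>m. fibbin (odd_lift m))"
    by (auto simp: fibbin_odd_lift)
qed

lemma enumerate_range_strict_mono:
  fixes f :: "nat \<Rightarrow> nat"
  assumes "strict_mono f"
  shows "enumerate (range f) n = f n"
proof (induction n)
  case 0
  show ?case
    unfolding enumerate_0 using assms
    by (intro Least_equality) (auto simp: strict_mono_less_eq)
next
  case (Suc n)
  have "infinite (range f)"
    using assms by (simp add: strict_mono_imp_inj_on range_inj_infinite)
  then have "enumerate (range f) (Suc n) = (LEAST s. s \<in> range f \<and> f n < s)"
    by (simp add: enumerate_Suc'' Suc)
  also have "\<dots> = f (Suc n)"
    using assms
    by (intro Least_equality) (auto simp: strict_mono_less strict_mono_less_eq)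
  finally show ?case .
qed

text \<open>The shift of index arises because \<open>odfib\<close> counts from 1, while
  \<open>odd_lift 0 = 1\<close> already yields the first odd fibbinary number.\<close>

lemma odfib_Suc: "odfib (Suc m) = fibbin (odd_lift m)"
proof -
  have "strict_mono (\<lambda>m. fibbin (odd_lift m))"
    by (rule strict_monoI) (simp add: fibbin_odd_lift fibbin_less_iff)
  from enumerate_range_strict_mono[OF this, of m] show ?thesis
    unfolding odfib_def range_odd_fibbinary by simp
qed

lemma Z_Suc: "Z (Suc m) = odd_lift m"
proof -
  have "odd_lift m \<in> {0<..}" by (simp add: odd_lift_def)
  then show ?thesis
    unfolding Z_def odfib_Suc
    by (intro inv_into_f_f inj_on_subset[OF inj_fibbin]) simp_all
qed

section \<open>The golden ratio\<close>

lemma golden_ratio_squared: "golden_ratio ^ 2 = golden_ratio + 1"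
  by (simp add: golden_ratio_def power2_eq_square field_simps)

lemma golden_ratio_bounds: "1 < golden_ratio" "golden_ratio < 2"
proof -
  have "1 < sqrt 5" "sqrt 5 < 3"
    by (auto intro: real_less_rsqrt real_less_lsqrt)
  then show "1 < golden_ratio" "golden_ratio < 2"
    by (auto simp: golden_ratio_def)
qed

text \<open>Both sides obey the Fibonacci recurrence, since \<open>1 - golden_ratio\<close> is the
  other root of \<open>x ^ 2 = x + 1\<close>, and they agree at 0 and 1.\<close>

lemma fib_Suc_minus_golden_ratio:
  "real (fib (Suc i)) - golden_ratio * real (fib i) = (1 - golden_ratio) ^ i"
proof (induction i rule: fib.induct)
  case (3 i)
  have "(1 - golden_ratio) ^ 2 = (1 - golden_ratio) + 1"
    using golden_ratio_squared by (simp add: power2_eq_square algebra_simps)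
  then have "(1 - golden_ratio) ^ Suc (Suc i)
      = (1 - golden_ratio) ^ Suc i + (1 - golden_ratio) ^ i"
    by (simp only: power_Suc power2_eq_square mult.assoc[symmetric] distrib_right mult_1)
  then show ?case
    unfolding "3.IH"[symmetric] by (simp add: algebra_simps)
qed auto

text \<open>
  The even and the odd powers are bounded separately; the gaps \<open>q ^ (2 * N + 1)\<close> and
  \<open>q ^ (2 * N + 2)\<close> are the tails of the two geometric series.
\<close>

lemma sum_alternating_powers_aux:
  fixes q :: real
  assumes q: "0 < q" "q ^ 2 = 1 - q"
  shows "(\<Sum>i=2..<2 * N + 2. if i \<in> I then (- q) ^ i else 0) \<le> q - q ^ (2 * N + 1)"
    and "- (q ^ 2) + q ^ (2 * N + 2) \<le> (\<Sum>i=2..<2 * N + 2. if i \<in> I then (- q) ^ i else 0)"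
proof (induction N)
  case 0
  { case 1 show ?case by simp
  next case 2 show ?case by (simp add: power2_eq_square) }
next
  case (Suc N)
  let ?S = "\<lambda>N. \<Sum>i=2..<2 * N + 2. if i \<in> I then (- q) ^ i else 0"
  have S: "?S (Suc N) = ?S N + (if 2 * N + 2 \<in> I then q ^ (2 * N + 2) else 0)
      - (if 2 * N + 3 \<in> I then q ^ (2 * N + 3) else 0)"
  proof -
    have "{2..<2 * Suc N + 2} = insert (2 * N + 2) (insert (2 * N + 3) {2..<2 * N + 2})"
      by auto
    moreover have "(- q) ^ (2 * N + 2) = q ^ (2 * N + 2)" "(- q) ^ (2 * N + 3) = - (q ^ (2 * N + 3))"
      by simp_all
    ultimately show ?thesis
      by (simp del: power_minus_odd power_add_numeral2 power_add_numeral)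
  qed
  have pos: "0 < q ^ (2 * N + 2)" "0 < q ^ (2 * N + 3)"
    using q by auto
  \<comment> \<open>The equation \<open>q ^ 2 = 1 - q\<close>, multiplied by \<open>q ^ k\<close>,
    makes the tails telescope.\<close>
  have step: "q ^ l = q ^ k - q ^ j" if "j = k + 1" "l = k + 2" for j k l
    unfolding that power_add q(2) by (simp add: right_diff_distrib)
  have "q ^ (2 * N + 3) = q ^ (2 * N + 1) - q ^ (2 * N + 2)"
    and "q ^ (2 * N + 4) = q ^ (2 * N + 2) - q ^ (2 * N + 3)"
    by (rule step; simp)+
  moreover have "2 * Suc N + 1 = 2 * N + 3" "2 * Suc N + 2 = 2 * N + 4"
    by simp_all
  ultimately have e: "q ^ (2 * Suc N + 1) = q ^ (2 * N + 1) - q ^ (2 * N + 2)"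
    "q ^ (2 * Suc N + 2) = q ^ (2 * N + 2) - q ^ (2 * N + 3)"
    by metis+
  \<comment> \<open>The upper bound is worst when only the even exponent is present, the lower bound
    when only the odd one is.\<close>
  have b: "0 \<le> (if P then x else 0) \<and> (if P then x else 0) \<le> x" if "0 < x" for P and x :: real
    using that by simp
  note b = b[OF pos(1), of "2 * N + 2 \<in> I"] b[OF pos(2), of "2 * N + 3 \<in> I"]
  { case 1
    show ?case unfolding S e using Suc.IH(1) b by linarith
  next
    case 2
    show ?case unfolding S e using Suc.IH(2) b by linarith }
qed

text \<open>The lower end is \<open>q - 1 = - (q ^ 2)\<close>. Finiteness of \<open>I\<close> leaves
  a positive tail on either side, which makes both bounds strict.\<close>

lemma sum_alternating_powers_bounds:
  fixes q :: real
  assumes q: "0 < q" "q ^ 2 = 1 - q" and I: "finite I" "\<And>i. i \<in> I \<Longrightarrow> 2 \<le> i"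
  shows "q - 1 < (\<Sum>i\<in>I. (- q) ^ i)" "(\<Sum>i\<in>I. (- q) ^ i) < q"
proof -
  obtain N where N: "\<And>i. i \<in> I \<Longrightarrow> i < N"
    using I(1) finite_nat_set_iff_bounded by auto
  have "I \<subseteq> {2..<2 * N + 2}"
    using N I(2) by fastforce
  then have "(\<Sum>i\<in>I. (- q) ^ i) = (\<Sum>i=2..<2 * N + 2. if i \<in> I then (- q) ^ i else 0)"
    by (intro sum.mono_neutral_cong_left) auto
  then show "q - 1 < (\<Sum>i\<in>I. (- q) ^ i)" "(\<Sum>i\<in>I. (- q) ^ i) < q"
    using sum_alternating_powers_aux[OF q, where I = I and N = N] q
      zero_less_power[OF q(1), of "2 * N + 1"] zero_less_power[OF q(1), of "2 * N + 2"]
    by linarith+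
qed

lemma odd_lift_eq: "int (odd_lift m) = \<lfloor>real (m + 1) * golden_ratio\<rfloor> + int m"
proof -
  let ?I = "zeckendorf m"
  \<comment> \<open>By the Fibonacci recurrence, the sum shifted by two in \<open>odd_lift\<close>
    equals \<open>s + m\<close>.\<close>
  define s where "s = (\<Sum>i\<in>?I. fib (Suc i))"
  have I: "finite ?I" "\<And>i. i \<in> ?I \<Longrightarrow> 2 \<le> i"
    using zeckendorf_rep_zeckendorf[of m] unfolding zeckendorf_rep_def by blast+
  have m: "(\<Sum>i\<in>?I. fib i) = m"
    using zeckendorf_rep_zeckendorf[of m] unfolding zeckendorf_rep_def by (elim conjE) (rule sym)
  then have "real m = (\<Sum>i\<in>?I. real (fib i))"
    by (simp flip: of_nat_sum)
  then have "real s - golden_ratio * real m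
      = (\<Sum>i\<in>?I. real (fib (Suc i)) - golden_ratio * real (fib i))"
    unfolding s_def of_nat_sum sum_subtractf sum_distrib_left[symmetric] by (rule arg_cong)
  then have "real s - golden_ratio * real m = (\<Sum>i\<in>?I. (- (golden_ratio - 1)) ^ i)"
    by (simp add: fib_Suc_minus_golden_ratio)
  moreover have "(golden_ratio - 1) ^ 2 = 1 - (golden_ratio - 1)"
    using golden_ratio_squared by (simp add: power2_eq_square algebra_simps)
  ultimately have "golden_ratio - 2 < real s - golden_ratio * real m"
      "real s - golden_ratio * real m < golden_ratio - 1"
    using sum_alternating_powers_bounds[of "golden_ratio - 1", OF _ _ I(1,2)] golden_ratio_bounds
    by auto
  \<comment> \<open>With \<open>d = s - golden_ratio * m\<close>, the product is
    \<open>s + (golden_ratio - d)\<close>, and the bracket lies strictly between 1 and 2.\<close>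
  then have "\<lfloor>real (m + 1) * golden_ratio\<rfloor> = int s + 1"
    by (intro floor_unique) (auto simp: algebra_simps)
  moreover have "odd_lift m = 1 + s + m"
    using m by (simp add: odd_lift_def s_def sum.distrib)
  ultimately show ?thesis by simp
qed

theorem theorem1:
  fixes n :: nat
  assumes "n \<ge> 1"
  shows "(\<forall>j>0. (odd (fibbin j) \<and> fibbin j = odfib n) \<longleftrightarrow> j = Z n) \<and>
         int (Z n) = \<lfloor>real n * golden_ratio ^ 2\<rfloor> - 1 \<and>
         \<lfloor>real n * golden_ratio ^ 2\<rfloor> - 1 = \<lfloor>real n * golden_ratio\<rfloor> + int n - 1"
proof -
  obtain m where n: "n = Suc m"
    using assms by (cases n) auto
  have "odd (odfib n)"
    by (simp add: n odfib_Suc fibbin_odd_lift)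
  then have "\<forall>j>0. (odd (fibbin j) \<and> fibbin j = odfib n) \<longleftrightarrow> j = Z n"
    by (auto simp: n odfib_Suc Z_Suc inj_eq[OF inj_fibbin])
  \<comment> \<open>Since \<open>golden_ratio ^ 2 = golden_ratio + 1\<close>, the arguments of the
    two floors differ by the integer \<open>n\<close>.\<close>
  moreover have "\<lfloor>real n * golden_ratio ^ 2\<rfloor> = \<lfloor>real n * golden_ratio\<rfloor> + int n"
    by (simp add: golden_ratio_squared distrib_left floor_add_int[of _ "int n", simplified])
  moreover have "int (Z n) = \<lfloor>real n * golden_ratio\<rfloor> + int n - 1"
    using odd_lift_eq[of m] by (simp add: n Z_Suc)
  ultimately show ?thesis by simp
qed

end
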